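(* Let $d\in\mathbb{Z}_{>0}$ be squarefree, let $K=\mathbb{Q}(\sqrt{-d})$, and let $\mathcal{O}_K$ be its ring of integers. Let $D(X)=(2X+1)(3X+1)$ and $H_0(X)=2(2X+1)^2+1$ in $\mathbb{Z}[X]$. Let $z_1,z_2\in\mathcal{O}_K$, and set $$h=H_0(z_1)H_0(z_2)\in\mathcal{O}_K\setminus\{0\}.$$ Then the following three statements are equivalent. (1) $z_1,z_2\in\mathbb{Z}$. (2) For every $t\in\mathbb{Z}\setminus\{0\}$ there exist $v,x\in\mathbb{Z}$ such that, on setting $$s=vt,\quad y=sh,\quad b=3y^2+1,\quad c=3y^2\left(2(z_1+yz_2)+1-xy^2\right)^2+1,$$ one has $b,c\in\operatorname{Sq}(\mathbb{Z})$ and $s\mid D(x)$ in $\mathbb{Z}$. (3) There exist $s\in\mathcal{O}_K\setminus\{0\}$ and $x\in\mathcal{O}_K$ such that, on setting $$y=sh,\quad b=3y^2+1,\quad c=3y^2\left(2(z_1+yz_2)+1-xy^2\right)^2+1,$$ one has $b,c\in\operatorname{Sq}(\mathcal{O}_K)$.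
   Context: For a commutative ring $A$, $\operatorname{Sq}(A)=\{r^2\colon r\in A\}$, and for $a,b\in A$, $a\mid b$ in $A$ means $b=ac$ for some $c\in A$. For every $z\in\mathcal{O}_K$ one has $H_0(z)\neq 0$, since the roots of $2Z^2+1$ are not algebraic integers. *)

theory Defs
  imports Complex_Main "HOL-Computational_Algebra.Computational_Algebra" "HOL-Analysis.Complex_Transcendental"
begin

definition subfield_of_complex :: "complex set \<Rightarrow> bool" where
  "subfield_of_complex F \<longleftrightarrow>
     1 \<in> F \<and> (\<forall>a\<in>F. \<forall>b\<in>F. a - b \<in> F \<and> a * b \<in> F) \<and> (\<forall>a\<in>F. a \<noteq> 0 \<longrightarrow> inverse a \<in> F)"

definition rat_adjoin :: "complex \<Rightarrow> complex set" where
  "rat_adjoin \<alpha> = \<Inter>{F. subfield_of_complex F \<and> \<alpha> \<in> F}"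

text \<open>The field \<open>K = \<rat>(\<surd>-d)\<close> and its ring of integers are realized inside the complex numbers.\<close>

definition imag_quadratic_field :: "nat \<Rightarrow> complex set" where
  "imag_quadratic_field d = rat_adjoin (csqrt (- of_nat d))"

definition ring_of_integers :: "complex set \<Rightarrow> complex set" where
  "ring_of_integers K = {z \<in> K. algebraic_int z}"

text \<open>A subring is represented by its carrier set in an ambient ring; in particular
  \<open>Sq \<int>\<close>, for \<open>\<int>\<close> of type \<^typ>\<open>complex set\<close>, consists of the complex numbers
  that are squares of rational integers.\<close>

definition Sq :: "'a::comm_ring_1 set \<Rightarrow> 'a set" where
  "Sq A = {r\<^sup>2 | r. r \<in> A}"

definition D_poly :: "int poly" where
  "D_poly = (2 * [:0, 1:] + 1) * (3 * [:0, 1:] + 1)"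

definition H0_poly :: "int poly" where
  "H0_poly = 2 * (2 * [:0, 1:] + 1)\<^sup>2 + 1"

definition H0 :: "complex \<Rightarrow> complex" where
  "H0 z = poly (map_poly of_int H0_poly) z"

lemma poly_D_poly: "poly D_poly x = (2 * x + 1) * (3 * x + 1)"
  by (simp add: D_poly_def algebra_simps)

lemma H0_eq: "H0 z = 2 * (2 * z + 1)\<^sup>2 + 1"
proof -
  have H: "H0_poly = [:3, 8, 8:]"
    by (simp add: H0_poly_def power2_eq_square numeral_poly one_pCons)
  show ?thesis
    unfolding H0_def H by (simp add: map_poly_pCons power2_eq_square algebra_simps)
qed

lemma subfield_of_complex_Rats:
  assumes F: "subfield_of_complex F" and q: "q \<in> \<rat>"
  shows "q \<in> F"
proof -
  have one: "1 \<in> F" and diff: "\<And>a b. a \<in> F \<Longrightarrow> b \<in> F \<Longrightarrow> a - b \<in> F"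
    and mult: "\<And>a b. a \<in> F \<Longrightarrow> b \<in> F \<Longrightarrow> a * b \<in> F"
    and inv: "\<And>a. a \<in> F \<Longrightarrow> a \<noteq> 0 \<Longrightarrow> inverse a \<in> F"
    using F by (auto simp: subfield_of_complex_def)
  have zero: "0 \<in> F" using diff[OF one one] by simp
  have neg: "- a \<in> F" if "a \<in> F" for a using diff[OF zero that] by simp
  have nat: "of_nat n \<in> F" for n
  proof (induction n)
    case (Suc n)
    show ?case using diff[OF one neg[OF Suc]] by simp
  qed (simp add: zero)
  have int: "of_int k \<in> F" for k
    by (cases k rule: int_cases2) (use nat neg in auto)
  obtain a b where "b \<noteq> 0" "q = of_int a / of_int b"
    using q by (metis Rats_cases' less_irrefl)
  then show ?thesis
    using mult[OF int[of a] inv[OF int[of b]]] by (simp add: divide_inverse)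
qed

lemma imag_quadratic_field_eq:
  assumes "d > 0"
  shows "imag_quadratic_field d = {a + b * csqrt (- of_nat d) | a b. a \<in> \<rat> \<and> b \<in> \<rat>}"
    (is "_ = ?Q")
proof -
  define w where "w = csqrt (- of_nat d)"
  have w2: "w * w = - of_nat d"
    unfolding w_def by (metis power2_csqrt power2_eq_square)
  have Q: "?Q = {a + b * w | a b. a \<in> \<rat> \<and> b \<in> \<rat>}" by (simp add: w_def)
  have "subfield_of_complex ?Q"
    unfolding subfield_of_complex_def
  proof (intro conjI ballI impI)
    show "1 \<in> ?Q" unfolding Q by (rule CollectI, rule exI[of _ 1], rule exI[of _ 0]) simp
  next
    fix x y assume "x \<in> ?Q" "y \<in> ?Q"
    then obtain a b a' b' where x: "x = a + b * w" and y: "y = a' + b' * w"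
      and r: "a \<in> \<rat>" "b \<in> \<rat>" "a' \<in> \<rat>" "b' \<in> \<rat>" unfolding Q by blast
    have "x - y = (a - a') + (b - b') * w" by (simp add: x y algebra_simps)
    then show "x - y \<in> ?Q" unfolding Q using r by (blast intro: Rats_diff)
    have "x * y = a * a' + (a * b' + b * a') * w + b * b' * (w * w)"
      by (simp add: x y algebra_simps)
    then have "x * y = (a * a' - b * b' * of_nat d) + (a * b' + b * a') * w"
      by (simp add: w2)
    moreover have "a * a' - b * b' * of_nat d \<in> \<rat>" "a * b' + b * a' \<in> \<rat>"
      using r by auto
    ultimately show "x * y \<in> ?Q" unfolding Q by blast
  next
    fix x assume "x \<in> ?Q" "x \<noteq> 0"
    then obtain a b where x: "x = a + b * w" and r: "a \<in> \<rat>" "b \<in> \<rat>" unfolding Q by blast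
    define N where "N = a * a + b * b * of_nat d"
    obtain p q where p: "a = of_rat p" and q: "b = of_rat q" using r by (auto elim!: Rats_cases)
    have Np: "N = of_rat (p * p + q * q * of_nat d)"
      by (simp add: N_def p q of_rat_add of_rat_mult)
    have "N \<noteq> 0"
    proof
      assume "N = 0"
      then have "p * p + q * q * of_nat d = 0" unfolding Np by simp
      moreover have "p * p \<ge> 0" "q * q * of_nat d \<ge> 0" by auto
      ultimately have "p * p = 0" "q * q * of_nat d = 0" by linarith+
      then show False using \<open>x \<noteq> 0\<close> assms by (auto simp: x p q)
    qed
    have "x * (a - b * w) = a * a - b * b * (w * w)" by (simp add: x algebra_simps)
    then have "x * (a - b * w) = N" by (simp add: w2 N_def)
    then have "inverse x = (a - b * w) / N"
      using \<open>N \<noteq> 0\<close> \<open>x \<noteq> 0\<close> by (simp add: field_simps)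
    then have "inverse x = a / N + (- b / N) * w" by (simp add: diff_divide_distrib)
    moreover have "N \<in> \<rat>" using r by (auto simp: N_def)
    then have "a / N \<in> \<rat>" "- b / N \<in> \<rat>" using r by auto
    ultimately show "inverse x \<in> ?Q" unfolding Q by blast
  qed
  moreover have "w \<in> ?Q"
    unfolding Q by (rule CollectI, rule exI[of _ 0], rule exI[of _ 1]) simp
  ultimately have "imag_quadratic_field d \<subseteq> ?Q"
    unfolding imag_quadratic_field_def rat_adjoin_def w_def by blast
  moreover have "?Q \<subseteq> F" if F: "subfield_of_complex F" and wF: "w \<in> F" for F
  proof
    fix x assume "x \<in> ?Q"
    then obtain a b where x: "x = a + b * w" and r: "a \<in> \<rat>" "b \<in> \<rat>" unfolding Q by blast
    have diff: "\<And>a b. a \<in> F \<Longrightarrow> b \<in> F \<Longrightarrow> a - b \<in> F"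
      and mult: "\<And>a b. a \<in> F \<Longrightarrow> b \<in> F \<Longrightarrow> a * b \<in> F"
      using F by (auto simp: subfield_of_complex_def)
    have "a \<in> F" "- b \<in> F" using subfield_of_complex_Rats[OF F] r by auto
    from diff[OF this(1) mult[OF this(2) wF]] show "x \<in> F" by (simp add: x)
  qed
  then have "?Q \<subseteq> imag_quadratic_field d"
    unfolding imag_quadratic_field_def rat_adjoin_def w_def by blast
  ultimately show ?thesis by blast
qed

end

theory Submission
  imports Defs "Jordan_Normal_Form.Char_Poly"
begin

text \<open>
  If \<open>3 y\<^sup>2 + 1\<close> and \<open>3 y\<^sup>2 q\<^sup>2 + 1\<close> are squares in the ring of integers, then \<open>y\<close> and \<open>y q\<close>
  are rational integers, because the equation \<open>X\<^sup>2 - 3 Y\<^sup>2 = 1\<close> acquires no new solutions over an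
  imaginary quadratic ring. So \<open>q = 2 (z1 + y z2) + 1 - x y\<^sup>2\<close> is real, and comparing it with its
  conjugate shows that \<open>y\<close>, a multiple of \<open>H0 z1\<close>, divides \<open>2 (z1 - cnj z1)\<close>; by size this is
  impossible unless \<open>z1\<close> is real. The same argument then applies to \<open>z2\<close>. Conversely, for
  \<open>z1, z2 \<in> \<int>\<close> one takes \<open>y\<close> from the Pell sequence divisible by a prescribed integer; the values of
  \<open>q\<close> that it admits are controlled modulo \<open>y\<^sup>4\<close>, which leaves \<open>x\<close> free modulo \<open>y\<close>.
\<close>

section \<open>Algebraic integers form a ring\<close>

text \<open>The nonzero vector \<open>v\<close> is an eigenvector of the integer matrix
  \<open>A\<close> with eigenvalue \<open>z\<close>, so \<open>z\<close> is a root of a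
  characteristic polynomial that is monic over the integers.\<close>

lemma algebraic_int_if_int_matrix:
  fixes v :: "nat \<Rightarrow> 'a::field_char_0" and A :: "nat \<Rightarrow> nat \<Rightarrow> int"
  assumes k: "k < n" "v k \<noteq> 0"
    and A: "\<And>i. i < n \<Longrightarrow> z * v i = (\<Sum>j<n. of_int (A i j) * v j)"
  shows "algebraic_int z"
proof -
  define M where "M = mat n n (\<lambda>(i, j). A i j)"
  define B where "B = map_mat (of_int :: int \<Rightarrow> 'a) M"
  have M: "M \<in> carrier_mat n n" by (simp add: M_def)
  have B: "B \<in> carrier_mat n n" by (simp add: B_def M_def)
  have "eigenvector B (vec n v) z"
    unfolding eigenvector_def
  proof (intro conjI)
    show "vec n v \<in> carrier_vec (dim_row B)" using B by simp
    show "vec n v \<noteq> 0\<^sub>v (dim_row B)"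
    proof
      assume "vec n v = 0\<^sub>v (dim_row B)"
      then have "vec n v $ k = 0\<^sub>v n $ k" using B by simp
      with k show False by simp
    qed
    show "B *\<^sub>v vec n v = z \<cdot>\<^sub>v vec n v"
    proof (rule eq_vecI)
      fix i assume "i < dim_vec (z \<cdot>\<^sub>v vec n v)"
      then have i: "i < n" by simp
      have "(B *\<^sub>v vec n v) $ i = (\<Sum>j<n. of_int (A i j) * v j)"
        using i by (simp add: B_def M_def scalar_prod_def lessThan_atLeast0)
      then show "(B *\<^sub>v vec n v) $ i = (z \<cdot>\<^sub>v vec n v) $ i" using i A[OF i] by simp
    qed (use B in simp)
  qed
  then have "poly (char_poly B) z = 0"
    using eigenvalue_root_char_poly[OF B] by (auto simp: eigenvalue_def)
  then have "poly (map_poly of_int (char_poly M)) z = 0"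
    by (simp add: B_def of_int_hom.char_poly_hom[OF M])
  moreover have "lead_coeff (char_poly M) = 1"
    using degree_monic_char_poly[OF M] by simp
  ultimately show ?thesis by (auto simp: algebraic_int_altdef_ipoly)
qed

section \<open>Finitely generated modules over the integers and integrality\<close>

definition int_span :: "('b \<Rightarrow> 'a::comm_ring_1) \<Rightarrow> 'b set \<Rightarrow> 'a set" where
  "int_span v I = range (\<lambda>c. \<Sum>j\<in>I. of_int (c j) * v j)"

lemma int_spanI: "a = (\<Sum>j\<in>I. of_int (c j) * v j) \<Longrightarrow> a \<in> int_span v I"
  by (simp add: int_span_def)

lemma int_span_add: "a \<in> int_span v I \<Longrightarrow> b \<in> int_span v I \<Longrightarrow> a + b \<in> int_span v I"
proof -
  assume "a \<in> int_span v I" "b \<in> int_span v I"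
  then obtain c c' where "a = (\<Sum>j\<in>I. of_int (c j) * v j)" "b = (\<Sum>j\<in>I. of_int (c' j) * v j)"
    by (auto simp: int_span_def)
  then have "a + b = (\<Sum>j\<in>I. of_int (c j + c' j) * v j)"
    by (simp add: sum.distrib algebra_simps)
  then show ?thesis by (rule int_spanI)
qed

lemma int_span_scale: "a \<in> int_span v I \<Longrightarrow> of_int k * a \<in> int_span v I"
proof -
  assume "a \<in> int_span v I"
  then obtain c where "a = (\<Sum>j\<in>I. of_int (c j) * v j)"
    by (auto simp: int_span_def)
  then have "of_int k * a = (\<Sum>j\<in>I. of_int (k * c j) * v j)"
    by (simp add: sum_distrib_left mult.assoc)
  then show ?thesis by (rule int_spanI)
qed

lemma int_span_sum:
  "(\<And>i. i \<in> J \<Longrightarrow> f i \<in> int_span v I) \<Longrightarrow> (\<Sum>i\<in>J. of_int (k i) * f i) \<in> int_span v I"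
proof (induction J rule: infinite_finite_induct)
  case (insert x F)
  then show ?case by (simp add: int_span_add int_span_scale)
qed (auto simp: int_span_def intro!: image_eqI[of _ _ "\<lambda>_. 0"])

lemma int_span_base:
  assumes "finite I" "i \<in> I"
  shows "v i \<in> int_span v I"
proof -
  have "(\<Sum>j\<in>I. of_int (if j = i then 1 else 0) * v j) = (\<Sum>j\<in>I. if j = i then v j else 0)"
    by (intro sum.cong) auto
  also have "\<dots> = v i" using assms by simp
  finally show ?thesis by (metis int_spanI)
qed

lemma int_span_times:
  assumes "\<And>i. i \<in> I \<Longrightarrow> z * v i \<in> int_span v I" "a \<in> int_span v I"
  shows "z * a \<in> int_span v I"
proof -
  obtain c where a: "a = (\<Sum>j\<in>I. of_int (c j) * v j)"
    using assms(2) by (auto simp: int_span_def)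
  have "z * a = (\<Sum>j\<in>I. of_int (c j) * (z * v j))"
    by (simp add: a sum_distrib_left algebra_simps)
  then show ?thesis by (simp only:) (intro int_span_sum assms(1))
qed

text \<open>Numbering \<open>I\<close> reduces this to the matrix criterion. The index type is left
  arbitrary so that pairs of exponents can index a family of monomials.\<close>

lemma algebraic_int_if_stable_int_span:
  fixes v :: "'b \<Rightarrow> 'a::field_char_0"
  assumes fin: "finite I" and k: "k \<in> I" "v k \<noteq> 0"
    and stable: "\<And>i. i \<in> I \<Longrightarrow> z * v i \<in> int_span v I"
  shows "algebraic_int z"
proof -
  have "\<forall>i\<in>I. \<exists>c. z * v i = (\<Sum>j\<in>I. of_int (c j) * v j)"
    using stable by (auto simp: int_span_def)
  then obtain A where A: "\<And>i. i \<in> I \<Longrightarrow> z * v i = (\<Sum>j\<in>I. of_int (A i j) * v j)"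
    by metis
  obtain f where f: "bij_betw f {0..<card I} I"
    using ex_bij_betw_nat_finite[OF fin] by blast
  then obtain l where l: "l < card I" "f l = k"
    using k(1) by (force simp: bij_betw_def)
  show ?thesis
  proof (rule algebraic_int_if_int_matrix[of l "card I" "\<lambda>i. v (f i)" _ "\<lambda>i j. A (f i) (f j)"])
    fix i assume "i < card I"
    then have "f i \<in> I" using f by (auto simp: bij_betw_def)
    then show "z * v (f i) = (\<Sum>j<card I. of_int (A (f i) (f j)) * v (f j))"
      using sum.reindex_bij_betw[OF f, of "\<lambda>j. of_int (A (f i) j) * v j"]
      by (simp add: A lessThan_atLeast0)
  qed (use l k in auto)
qed

lemma algebraic_int_power_reduce:
  fixes x :: "'a::field_char_0"
  assumes "algebraic_int x"
  obtains m c where "m > 0" "x ^ m = (\<Sum>i<m. of_int (c i) * x ^ i)"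
proof -
  obtain p where p: "poly (map_poly of_int p) x = 0" "lead_coeff p = 1"
    using assms by (auto simp: algebraic_int_altdef_ipoly)
  define m where "m = degree p"
  have m: "m > 0"
  proof (rule ccontr)
    assume "\<not> m > 0"
    then have "p = 1" using p(2) monic_degree_0[of p] by (simp add: m_def)
    with p(1) show False by simp
  qed
  have "0 = (\<Sum>i\<le>m. of_int (coeff p i) * x ^ i)"
    using p(1) by (simp add: poly_altdef m_def coeff_map_poly degree_map_poly)
  also have "\<dots> = (\<Sum>i<m. of_int (coeff p i) * x ^ i) + x ^ m"
    using p(2) by (simp add: m_def flip: lessThan_Suc_atMost)
  finally have "x ^ m = (\<Sum>i<m. of_int (- coeff p i) * x ^ i)"
    by (simp add: sum_negf eq_neg_iff_add_eq_0 add.commute)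
  then show ?thesis by (rule that[OF m])
qed

text \<open>The monomials \<open>x ^ i * y ^ j\<close> with exponents below the degrees of monic
  relations for \<open>x\<close> and \<open>y\<close> span a module stable under both factors, hence
  under their sum and product.\<close>

lemma
  fixes x y :: "'a::field_char_0"
  assumes "algebraic_int x" "algebraic_int y"
  shows algebraic_int_add: "algebraic_int (x + y)"
    and algebraic_int_mult: "algebraic_int (x * y)"
proof -
  obtain m c where m: "m > 0" and x: "x ^ m = (\<Sum>i<m. of_int (c i) * x ^ i)"
    using algebraic_int_power_reduce[OF assms(1)] .
  obtain n e where n: "n > 0" and y: "y ^ n = (\<Sum>i<n. of_int (e i) * y ^ i)"
    using algebraic_int_power_reduce[OF assms(2)] .
  define I where "I = {..<m} \<times> {..<n}"
  define v where "v = (\<lambda>(i, j). x ^ i * y ^ j)"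
  have fin: "finite I" by (simp add: I_def)
  have mem: "x ^ i * y ^ j \<in> int_span v I" if "i < m" "j < n" for i j
    using int_span_base[of I "(i, j)" v] that by (simp add: I_def v_def)
  have sx: "x * v k \<in> int_span v I" if "k \<in> I" for k
  proof -
    obtain i j where k: "k = (i, j)" "i < m" "j < n" using \<open>k \<in> I\<close> by (auto simp: I_def)
    show ?thesis
    proof (cases "Suc i < m")
      case True
      then show ?thesis using mem[of "Suc i" j] k by (simp add: v_def mult.assoc)
    next
      case False
      then have "m = Suc i" using k by simp
      then have "x * v k = x ^ m * y ^ j" using k by (simp add: v_def)
      also have "\<dots> = (\<Sum>i<m. of_int (c i) * (x ^ i * y ^ j))"
        unfolding x by (simp add: sum_distrib_right mult.assoc)
      finally show ?thesis by (simp only:) (intro int_span_sum mem, use k in auto)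
    qed
  qed
  have sy: "y * v k \<in> int_span v I" if "k \<in> I" for k
  proof -
    obtain i j where k: "k = (i, j)" "i < m" "j < n" using \<open>k \<in> I\<close> by (auto simp: I_def)
    show ?thesis
    proof (cases "Suc j < n")
      case True
      then show ?thesis using mem[of i "Suc j"] k by (simp add: v_def mult_ac)
    next
      case False
      then have "n = Suc j" using k by simp
      then have "y * v k = y ^ n * x ^ i" using k by (simp add: v_def mult_ac)
      also have "\<dots> = (\<Sum>j<n. of_int (e j) * (x ^ i * y ^ j))"
        unfolding y by (simp add: sum_distrib_left mult_ac)
      finally show ?thesis by (simp only:) (intro int_span_sum mem, use k in auto)
    qed
  qed
  have one: "(0, 0) \<in> I" "v (0, 0) \<noteq> 0" using m n by (auto simp: I_def v_def)
  show "algebraic_int (x + y)"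
    by (rule algebraic_int_if_stable_int_span[where v = v, OF fin one])
      (simp add: distrib_right int_span_add sx sy)
  show "algebraic_int (x * y)"
    by (rule algebraic_int_if_stable_int_span[where v = v, OF fin one])
      (simp add: mult.assoc int_span_times[OF sx] sy)
qed

section \<open>Rings of integers of imaginary quadratic fields\<close>

text \<open>These are the facts about the ring of integers from which (3) implies (1). The last one
  turns norms, traces and other conjugation-invariant elements into rational integers.\<close>

locale cnj_closed_subring =
  fixes R :: "complex set"
  assumes one_mem: "1 \<in> R"
    and diff_mem: "a \<in> R \<Longrightarrow> b \<in> R \<Longrightarrow> a - b \<in> R"
    and mult_mem: "a \<in> R \<Longrightarrow> b \<in> R \<Longrightarrow> a * b \<in> R"
    and cnj_mem: "a \<in> R \<Longrightarrow> cnj a \<in> R"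
    and Ints_if_cnj_eq: "a \<in> R \<Longrightarrow> cnj a = a \<Longrightarrow> a \<in> \<int>"
begin

lemma zero_mem: "0 \<in> R"
  using diff_mem[OF one_mem one_mem] by simp

lemma minus_mem: "a \<in> R \<Longrightarrow> - a \<in> R"
  using diff_mem[OF zero_mem] by simp

lemma add_mem: "a \<in> R \<Longrightarrow> b \<in> R \<Longrightarrow> a + b \<in> R"
  using diff_mem[of a "- b"] minus_mem by simp

lemma of_nat_mem: "of_nat n \<in> R"
  by (induction n) (auto simp: zero_mem one_mem add_mem)

lemma numeral_mem: "numeral n \<in> R"
  using of_nat_mem[of "numeral n"] by simp

lemma power_mem: "a \<in> R \<Longrightarrow> a ^ n \<in> R"
  by (induction n) (auto simp: one_mem mult_mem)

lemmas mem_intros =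
  zero_mem one_mem numeral_mem add_mem diff_mem minus_mem mult_mem power_mem cnj_mem

lemma H0_mem: "z \<in> R \<Longrightarrow> H0 z \<in> R"
  by (simp add: H0_eq mem_intros)

text \<open>A root would make the ring element \<open>(2 * z + 1)^2\<close> equal to -1/2, which is
  real but not a rational integer.\<close>

lemma H0_nonzero:
  assumes "z \<in> R"
  shows "H0 z \<noteq> 0"
proof
  assume "H0 z = 0"
  then have w: "(2 * z + 1)\<^sup>2 = - 1 / 2" unfolding H0_eq by Groebner_Basis.algebra
    \<comment> \<open>the unqualified name denotes the normalizer for HOL-Algebra rings\<close>
  have "(2 * z + 1)\<^sup>2 \<in> R" using assms by (intro mem_intros)
  then have "(2 * z + 1)\<^sup>2 \<in> \<int>" by (rule Ints_if_cnj_eq) (simp only: w, simp)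
  then obtain k where "(2 * z + 1)\<^sup>2 = of_int k" by (auto elim: Ints_cases)
  then have k: "complex_of_int k = - 1 / 2" using w by simp
  have "complex_of_int (2 * k + 1) = 2 * complex_of_int k + 1" by simp
  also have "\<dots> = 0" unfolding k by simp
  finally have "complex_of_int (2 * k + 1) = 0" .
  then have "2 * k + 1 = 0" by (simp only: of_int_eq_0_iff)
  then show False by presburger
qed

lemma norm_sq_int:
  assumes "a \<in> R"
  obtains n :: int where "n \<ge> 0" "a * cnj a = of_int n" "(cmod a)\<^sup>2 = of_int n"
proof -
  have "a * cnj a \<in> \<int>"
    by (rule Ints_if_cnj_eq) (use assms in \<open>auto intro: mem_intros\<close>)
  then obtain n where n: "a * cnj a = of_int n" by (auto elim: Ints_cases)
  then have "complex_of_real ((cmod a)\<^sup>2) = complex_of_real (of_int n)"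
    by (simp only: complex_norm_square of_real_of_int_eq)
  then have "(cmod a)\<^sup>2 = of_int n" by (simp only: of_real_eq_iff)
  moreover from this have "n \<ge> 0" by (metis of_int_0_le_iff zero_le_power2)
  ultimately show ?thesis using n that by blast
qed

lemma norm_ge_1:
  assumes "a \<in> R" "a \<noteq> 0"
  shows "cmod a \<ge> 1"
proof -
  obtain n where n: "n \<ge> 0" "(cmod a)\<^sup>2 = of_int n"
    using norm_sq_int[OF assms(1)] by metis
  with assms(2) have "n \<noteq> 0" by auto
  with n have "(cmod a)\<^sup>2 \<ge> 1\<^sup>2" by simp
  then show ?thesis by (rule power2_le_imp_le) simp
qed

text \<open>With \<open>w = cnj X * Y - X * cnj Y\<close>, the product of the equation with its conjugate reads
  \<open>(|X|\<^sup>2 - 3 |Y|\<^sup>2)\<^sup>2 - 3 w\<^sup>2 = 1\<close>. Here \<open>w\<^sup>2\<close> is a nonpositive integer, so \<open>w = 0\<close> and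
  \<open>|X|\<^sup>2 - 3 |Y|\<^sup>2 = \<plusminus>1\<close>, which makes \<open>X\<close> and \<open>Y\<close> both real or both purely imaginary.\<close>

lemma pell_solution_Ints:
  assumes X: "X \<in> R" and Y: "Y \<in> R" and pell: "X\<^sup>2 = 3 * Y\<^sup>2 + 1"
  shows "Y \<in> \<int>"
proof -
  obtain m where m: "m \<ge> 0" "X * cnj X = of_int m" using norm_sq_int[OF X] by metis
  obtain n where n: "n \<ge> 0" "Y * cnj Y = of_int n" using norm_sq_int[OF Y] by metis
  have cpell: "(cnj X)\<^sup>2 = 3 * (cnj Y)\<^sup>2 + 1"
    using arg_cong[OF pell, of cnj] by simp
  define w where "w = cnj X * Y - X * cnj Y"
  have w: "w = \<i> * of_real (Im w)" by (rule complex_eqI) (simp_all add: w_def)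
  have w2: "w\<^sup>2 = - of_real ((Im w)\<^sup>2)" by (subst w) (simp add: power_mult_distrib)
  have "w\<^sup>2 \<in> R" unfolding w_def by (intro mem_intros X Y)
  then have "w\<^sup>2 \<in> \<int>" by (rule Ints_if_cnj_eq) (simp add: w2)
  then obtain k where k: "w\<^sup>2 = of_int k" by (auto elim: Ints_cases)
  have "Re (w\<^sup>2) \<le> 0" by (simp only: w2) simp
  then have "k \<le> 0" by (simp add: k)
  have "(X * cnj X - 3 * (Y * cnj Y))\<^sup>2 - 3 * w\<^sup>2
      = (X\<^sup>2 - 3 * Y\<^sup>2) * ((cnj X)\<^sup>2 - 3 * (cnj Y)\<^sup>2)"
    unfolding w_def by Groebner_Basis.algebra
  also have "\<dots> = 1" by (simp add: pell cpell)
  finally have "of_int ((m - 3 * n)\<^sup>2 - 3 * k) = (1 :: complex)" by (simp add: m n k)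
  then have mnk: "(m - 3 * n)\<^sup>2 - 3 * k = 1" by (simp only: of_int_eq_1_iff)
  then have "k = 0" using \<open>k \<le> 0\<close> zero_le_power2[of "m - 3 * n"] by linarith
  then have "w = 0" using k by simp
  then have cross: "cnj X * Y = X * cnj Y" by (simp add: w_def)
  \<comment> \<open>By \<open>cross\<close>, conjugating \<open>X\<close> or \<open>Y\<close>
    amounts to multiplying it by \<open>m - 3 * n\<close>, a sign.\<close>
  have "X * (X * cnj X - 3 * (Y * cnj Y)) = cnj X * (X\<^sup>2 - 3 * Y\<^sup>2)"
    using cross by Groebner_Basis.algebra
  then have eX: "X * of_int (m - 3 * n) = cnj X" using pell by (simp add: m n)
  have "Y * (X * cnj X - 3 * (Y * cnj Y)) = cnj Y * (X\<^sup>2 - 3 * Y\<^sup>2)"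
    using cross by Groebner_Basis.algebra
  then have eY: "Y * of_int (m - 3 * n) = cnj Y" using pell by (simp add: m n)
  from mnk \<open>k = 0\<close> have "m - 3 * n = 1 \<or> m - 3 * n = - 1" by (simp add: power2_eq_1_iff)
  then show ?thesis
  proof
    assume "m - 3 * n = 1"
    with eY have "cnj Y = Y" by simp
    then show ?thesis by (rule Ints_if_cnj_eq[OF Y])
  next
    \<comment> \<open>In the imaginary case \<open>m * n\<close> is the square of the integer
      \<open>X * Y\<close>. Since \<open>m + 1 = 3 * n\<close>, the factors are coprime, so
      \<open>m\<close> would be a square congruent to -1 modulo 3.\<close>
    assume e: "m - 3 * n = - 1"
    with eX eY have cX: "cnj X = - X" and cY: "cnj Y = - Y" by simp_all
    have "X * Y \<in> \<int>" by (rule Ints_if_cnj_eq) (auto simp: cX cY X Y mult_mem)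
    then obtain l where l: "X * Y = of_int l" by (auto elim: Ints_cases)
    have "(X * Y)\<^sup>2 = (X * cnj X) * (Y * cnj Y)"
      by (simp add: cX cY power2_eq_square)
    then have "of_int (l\<^sup>2) = (of_int (m * n) :: complex)" by (simp add: l m n)
    then have "l\<^sup>2 = m * n" by (simp only: of_int_eq_iff)
    then have "nat \<bar>l\<bar> ^ 2 = nat m * nat n"
      using m(1) n(1) by (metis nat_abs_mult_distrib nat_power_eq abs_ge_zero power2_abs nat_mult_distrib)
    then have "is_nth_power 2 (nat m * nat n)" by (metis is_nth_powerI)
    moreover have s: "Suc (nat m) = 3 * nat n" using e m(1) n(1) by linarith
    then have "coprime (nat m) (nat n)"
      by (metis coprime_Suc_right_nat coprime_mult_right_iff)
    moreover have "n > 0" using e m(1) by linarith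
    then have "nat m > 0" "nat n > 0" using e by linarith+
    ultimately have "is_nth_power 2 (nat m)"
      using is_nth_power_mult_coprime_natD(1)[of "nat m" "nat n" 2] by blast
    then obtain r where r: "nat m = r ^ 2" by (auto elim: is_nth_powerE)
    have "Suc (r\<^sup>2) mod 3 = 0" using s r by simp
    moreover have "r mod 3 = 0 \<or> r mod 3 = 1 \<or> r mod 3 = 2" by presburger
    then have "Suc (r\<^sup>2) mod 3 \<noteq> 0"
      by (auto simp: mod_Suc power_mod[of r 3 2, symmetric])
    ultimately show ?thesis by simp
  qed
qed

text \<open>Otherwise \<open>r = |Im (2 z + 1)|\<close> satisfies \<open>r\<^sup>2 \<ge> 3\<close>, since the negative integer
  \<open>(z - cnj z)\<^sup>2\<close> is a discriminant, and \<open>|H0 z| \<ge> 2 r\<^sup>2 - 1 > 2 r\<close>.\<close>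

lemma Ints_if_H0_dvd_diff_cnj:
  assumes z: "z \<in> R" and g: "g \<in> R" "g \<noteq> 0" and r: "r \<in> R"
    and eq: "2 * (z - cnj z) = H0 z * g * r"
  shows "z \<in> \<int>"
proof (rule ccontr)
  assume "z \<notin> \<int>"
  then have im: "Im z \<noteq> 0" using Ints_if_cnj_eq[OF z] by (auto simp: complex_eq_iff)
  define t where "t = \<bar>Im (2 * z + 1)\<bar>"
  have t: "t = 2 * \<bar>Im z\<bar>" by (simp add: t_def)
  have diff: "z - cnj z = \<i> * of_real (2 * Im z)" by (rule complex_eqI) simp_all
  have nd: "cmod (z - cnj z) = t" unfolding diff norm_mult by (simp add: t)
  have "z + cnj z \<in> \<int>"
    by (rule Ints_if_cnj_eq) (use z in \<open>auto intro: mem_intros\<close>)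
  then obtain a where a: "z + cnj z = of_int a" by (auto elim: Ints_cases)
  obtain n where n: "z * cnj z = of_int n" using norm_sq_int[OF z] by metis
  have "(z - cnj z)\<^sup>2 = (z + cnj z)\<^sup>2 - 4 * (z * cnj z)" by Groebner_Basis.algebra
  then have "complex_of_real (- (t\<^sup>2)) = complex_of_real (of_int (a\<^sup>2 - 4 * n))"
    unfolding a n by (simp add: diff t power_mult_distrib)
  then have disc: "- (t\<^sup>2) = of_int (a\<^sup>2 - 4 * n)" by (simp only: of_real_eq_iff)
  have "t\<^sup>2 > 0" using im t by simp
  then have "real_of_int (a\<^sup>2 - 4 * n) < 0" using disc by linarith
  then have "a\<^sup>2 - 4 * n < 0" by (simp only: of_int_less_0_iff)
  \<comment> \<open>A discriminant is 0 or 1 modulo 4, so a negative one is at most -3.\<close>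
  moreover obtain l where "a\<^sup>2 = 4 * l \<or> a\<^sup>2 = 4 * l + 1"
  proof (cases "even a")
    case True
    then obtain b where "a = 2 * b" by (rule evenE)
    then have "a\<^sup>2 = 4 * b\<^sup>2" by simp
    then show ?thesis using that by blast
  next
    case False
    then obtain b where "a = 2 * b + 1" by (rule oddE)
    then have "a\<^sup>2 = 4 * (b\<^sup>2 + b) + 1" by (simp add: power2_eq_square algebra_simps)
    then show ?thesis using that by blast
  qed
  ultimately have "a\<^sup>2 - 4 * n \<le> - 3" by - (elim disjE; simp; presburger)
  then have "real_of_int (a\<^sup>2 - 4 * n) \<le> of_int (- 3)" by (simp only: of_int_le_iff)
  then have t3: "t\<^sup>2 \<ge> 3" using disc by simp
  \<comment> \<open>A rational number below sqrt 3 but above the larger root of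
    \<open>2 * t^2 - 2 * t - 1\<close>.\<close>
  have "t > 17 / 10"
    by (rule power2_less_imp_less) (use t3 in \<open>auto simp: power2_eq_square t\<close>)
  have "r \<noteq> 0" using eq im by (auto simp: complex_eq_iff)
  then have "cmod g * cmod r \<ge> 1"
    using norm_ge_1 g r by (metis mult_mem mult_eq_0_iff norm_mult)
  then have "cmod (H0 z) * 1 \<le> cmod (H0 z) * (cmod g * cmod r)"
    by (intro mult_left_mono) auto
  also have "\<dots> = cmod (2 * (z - cnj z))" by (simp only: eq norm_mult mult.assoc)
  also have "\<dots> = 2 * t" by (simp only: norm_mult nd) simp
  finally have up: "cmod (H0 z) \<le> 2 * t" by simp
  have "t\<^sup>2 \<le> (cmod (2 * z + 1))\<^sup>2"
    by (intro power_mono) (simp_all add: t_def abs_Im_le_cmod del: plus_complex.sel times_complex.sel)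
  then have "2 * t\<^sup>2 \<le> cmod (2 * (2 * z + 1)\<^sup>2)" by (simp add: norm_mult norm_power)
  also have "\<dots> \<le> cmod (H0 z) + 1"
    using norm_triangle_ineq4[of "H0 z" 1] by (simp add: H0_eq)
  finally have "2 * (t * t) \<le> 2 * t + 1" using up by (simp add: power2_eq_square)
  moreover have "17 / 10 * t \<le> t * t" using \<open>t > 17 / 10\<close> by simp
  ultimately show False using \<open>t > 17 / 10\<close> by argo
qed

lemma Ints_if_squares:
  assumes z1: "z1 \<in> R" and z2: "z2 \<in> R" and s: "s \<in> R" "s \<noteq> 0" and x: "x \<in> R"
    and y: "y = s * (H0 z1 * H0 z2)"
    and b: "3 * y\<^sup>2 + 1 \<in> Sq R"
    and c: "3 * y\<^sup>2 * (2 * (z1 + y * z2) + 1 - x * y\<^sup>2)\<^sup>2 + 1 \<in> Sq R"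
  shows "z1 \<in> \<int> \<and> z2 \<in> \<int>"
proof -
  have yR: "y \<in> R" unfolding y by (intro mem_intros H0_mem s z1 z2)
  have y0: "y \<noteq> 0" using H0_nonzero z1 z2 s by (simp add: y)
  define q where "q = 2 * (z1 + y * z2) + 1 - x * y\<^sup>2"
  have qR: "q \<in> R" unfolding q_def by (intro mem_intros yR z1 z2 x)
  obtain X where X: "X \<in> R" "X\<^sup>2 = 3 * y\<^sup>2 + 1" using b by (auto simp: Sq_def)
  then have "y \<in> \<int>" using pell_solution_Ints yR by blast
  then have cy: "cnj y = y" by (auto elim: Ints_cases)
  obtain Z where Z: "Z \<in> R" "Z\<^sup>2 = 3 * (y * q)\<^sup>2 + 1"
    using c by (auto simp: Sq_def q_def power_mult_distrib mult.assoc)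
  then have "y * q \<in> \<int>" using pell_solution_Ints yR qR mult_mem by blast
  then have "cnj (y * q) = y * q" by (metis Ints_cases complex_cnj_of_int)
  then have "cnj q = q" using cy y0 by simp
  then have "2 * (cnj z1 + y * cnj z2) + 1 - cnj x * y\<^sup>2 = 2 * (z1 + y * z2) + 1 - x * y\<^sup>2"
    by (simp add: q_def cy)
  then have eq: "2 * (z1 - cnj z1) = y * ((x - cnj x) * y - 2 * (z2 - cnj z2))"
    by Groebner_Basis.algebra
  have i1: "z1 \<in> \<int>"
  proof (rule Ints_if_H0_dvd_diff_cnj[OF z1])
    show "2 * (z1 - cnj z1) = H0 z1 * (s * H0 z2) * ((x - cnj x) * y - 2 * (z2 - cnj z2))"
      unfolding eq by (simp add: y mult_ac)
    show "s * H0 z2 \<noteq> 0" using H0_nonzero[OF z2] s by simp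
  qed (intro mem_intros H0_mem s z1 z2 x yR)+
  then have "cnj z1 = z1" by (auto elim: Ints_cases)
  \<comment> \<open>With \<open>z1\<close> real, the nonzero factor \<open>y\<close> cancels from
    \<open>eq\<close>, leaving a relation of the same shape for \<open>z2\<close>.\<close>
  then have "(x - cnj x) * y - 2 * (z2 - cnj z2) = 0" using eq y0 by simp
  then have eq2: "2 * (z2 - cnj z2) = y * (x - cnj x)" by (simp add: mult.commute)
  have "z2 \<in> \<int>"
  proof (rule Ints_if_H0_dvd_diff_cnj[OF z2])
    show "2 * (z2 - cnj z2) = H0 z2 * (s * H0 z1) * (x - cnj x)"
      unfolding eq2 by (simp add: y mult_ac)
    show "s * H0 z1 \<noteq> 0" using H0_nonzero[OF z1] s by simp
  qed (intro mem_intros H0_mem s z1 z2 x yR)+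
  with i1 show ?thesis ..
qed

end

text \<open>Conjugation changes the sign of \<open>b\<close> in \<open>a + b * w\<close>, so a fixed
  element is rational, and a rational algebraic integer is a rational integer.\<close>

lemma cnj_closed_subring_imag_quadratic:
  assumes d: "d > 0"
  shows "cnj_closed_subring (ring_of_integers (imag_quadratic_field d))"
proof
  let ?K = "imag_quadratic_field d"
  define w where "w = csqrt (- of_nat d)"
  have w: "w = \<i> * of_real (sqrt (real d))"
    using csqrt_of_real_nonpos[of "- complex_of_real (real d)"] by (simp add: w_def)
  have K: "?K = {a + b * w | a b. a \<in> \<rat> \<and> b \<in> \<rat>}"
    using imag_quadratic_field_eq[OF d] by (simp add: w_def)
  have Rats_cnj: "cnj q = q" if "q \<in> \<rat>" for q
    using that by (auto elim!: Rats_cases')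
  have Kdiff: "a - b \<in> ?K" and Kmult: "a * b \<in> ?K" if "a \<in> ?K" "b \<in> ?K" for a b
    using that by (auto simp: imag_quadratic_field_def rat_adjoin_def subfield_of_complex_def)
  show "1 \<in> ring_of_integers ?K"
    by (auto simp: ring_of_integers_def imag_quadratic_field_def rat_adjoin_def
        subfield_of_complex_def)
  show "a - b \<in> ring_of_integers ?K" if "a \<in> ring_of_integers ?K" "b \<in> ring_of_integers ?K" for a b
    using that algebraic_int_add[of a "- b"] by (auto simp: ring_of_integers_def Kdiff)
  show "a * b \<in> ring_of_integers ?K" if "a \<in> ring_of_integers ?K" "b \<in> ring_of_integers ?K" for a b
    using that by (auto simp: ring_of_integers_def Kmult algebraic_int_mult)
  show "cnj z \<in> ring_of_integers ?K" if z: "z \<in> ring_of_integers ?K" for z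
  proof -
    obtain a b where ab: "z = a + b * w" "a \<in> \<rat>" "b \<in> \<rat>"
      using z by (auto simp: ring_of_integers_def K)
    then have "cnj z = a + (- b) * w" by (simp add: Rats_cnj) (simp add: w)
    moreover have "- b \<in> \<rat>" using ab by simp
    ultimately have "cnj z \<in> ?K" using ab unfolding K by blast
    then show ?thesis using z by (auto simp: ring_of_integers_def)
  qed
  show "z \<in> \<int>" if z: "z \<in> ring_of_integers ?K" and c: "cnj z = z" for z
  proof -
    obtain a b where ab: "z = a + b * w" "a \<in> \<rat>" "b \<in> \<rat>"
      using z by (auto simp: ring_of_integers_def K)
    have "cnj z = a - b * w" using ab by (simp add: Rats_cnj) (simp add: w)
    then have "b * w = 0" using c ab by (simp add: eq_neg_iff_add_eq_0)
    then have "z \<in> \<rat>" using ab by (simp only: add_0_right)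
    then show ?thesis using z by (auto simp: ring_of_integers_def rational_algebraic_int_is_int)
  qed
qed

section \<open>Solutions over the integers\<close>

text \<open>The coordinates of the powers of the unit 2 + sqrt 3.\<close>

primrec pell :: "nat \<Rightarrow> int \<times> int" where
  "pell 0 = (1, 0)"
| "pell (Suc n) = (case pell n of (a, b) \<Rightarrow> (2 * a + 3 * b, a + 2 * b))"

lemma pell_eq: "(fst (pell n))\<^sup>2 = 3 * (snd (pell n))\<^sup>2 + 1"
  by (induction n) (auto split: prod.split simp: power2_eq_square algebra_simps)

lemma pell_nonneg: "fst (pell n) > 0 \<and> snd (pell n) \<ge> 0"
  by (induction n) (auto split: prod.split)

lemma inj_pell: "inj pell"
proof -
  have "strict_mono (\<lambda>n. snd (pell n))"
  proof (rule strict_mono_Suc_iff[THEN iffD2], rule allI)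
    fix n
    show "snd (pell n) < snd (pell (Suc n))"
      using pell_nonneg[of n] by (auto split: prod.split)
  qed
  then have "inj (\<lambda>n. snd (pell n))" by (rule strict_mono_imp_inj_on)
  then show ?thesis by (auto simp: inj_def)
qed

text \<open>Two distinct solutions that agree modulo \<open>n\<close> have a quotient that is trivial modulo \<open>n\<close>.\<close>

lemma pell_multiple:
  fixes n :: int
  assumes "n \<noteq> 0"
  obtains a y where "a\<^sup>2 = 3 * y\<^sup>2 + 1" "n dvd y" "y \<noteq> 0"
proof -
  define f where "f = (\<lambda>k. (fst (pell k) mod \<bar>n\<bar>, snd (pell k) mod \<bar>n\<bar>))"
  have "range f \<subseteq> {0..<\<bar>n\<bar>} \<times> {0..<\<bar>n\<bar>}" using assms by (auto simp: f_def)
  then have "finite (range f)" by (rule finite_subset) simp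
  then obtain i where "infinite {j. f j = f i}"
    using pigeonhole_infinite[of UNIV f] by auto
  then obtain j where j: "f j = f i" "j \<noteq> i"
    by (metis (mono_tags, lifting) finite.emptyI finite_insert finite_subset insertCI mem_Collect_eq subsetI)
  obtain a b where ab: "pell i = (a, b)" by force
  obtain c e where ce: "pell j = (c, e)" by force
  have pa: "a\<^sup>2 = 3 * b\<^sup>2 + 1" "a > 0" "b \<ge> 0" using pell_eq[of i] pell_nonneg[of i] ab by auto
  have pc: "c\<^sup>2 = 3 * e\<^sup>2 + 1" "c > 0" "e \<ge> 0" using pell_eq[of j] pell_nonneg[of j] ce by auto
  have n1: "n dvd c - a" and n2: "n dvd e - b"
    using j(1) by (auto simp: f_def ab ce mod_eq_dvd_iff)
  \<comment> \<open>This is the sqrt 3 coordinate of the quotient (c + e sqrt 3) / (a + b sqrt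
    3).\<close>
  have "a * e - b * c = a * (e - b) - b * (c - a)" by (simp add: algebra_simps)
  then have "n dvd a * e - b * c" using n1 n2 by simp
  moreover have "(a * c - 3 * b * e)\<^sup>2 = 3 * (a * e - b * c)\<^sup>2 + 1"
    using pa(1) pc(1) by Groebner_Basis.algebra
  moreover have "a * e - b * c \<noteq> 0"
  proof
    assume "a * e - b * c = 0"
    then have "e\<^sup>2 = b\<^sup>2" using pa(1) pc(1) by Groebner_Basis.algebra
    then have "e = b" using pa(3) pc(3) by (simp add: power2_eq_iff_nonneg)
    then have "c\<^sup>2 = a\<^sup>2" using pa(1) pc(1) by simp
    then have "c = a" using pa(2) pc(2) by (simp add: power2_eq_iff_nonneg)
    with \<open>e = b\<close> ab ce inj_pell j(2) show False by (metis injD)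
  qed
  ultimately show ?thesis using that by blast
qed

text \<open>For \<open>a\<^sup>2 = 3 w + 1\<close> with \<open>w = y\<^sup>2\<close>, the power \<open>(a + y \<surd>3) ^ (2 j + 1)\<close> equals
  \<open>a T + y U \<surd>3\<close> where \<open>(T, U) = pell_odd w j\<close>.\<close>

primrec pell_odd :: "int \<Rightarrow> nat \<Rightarrow> int \<times> int" where
  "pell_odd w 0 = (1, 1)"
| "pell_odd w (Suc j) = (case pell_odd w j of (T, U) \<Rightarrow>
     ((1 + 6 * w) * T + 6 * w * U, (1 + 6 * w) * U + 2 * (1 + 3 * w) * T))"

text \<open>Each recursion step multiplies by the square of a + y sqrt 3, of norm 1, and so
  preserves the norm of a T + y U sqrt 3.\<close>

lemma pell_odd_eq:
  "(1 + 3 * w) * (fst (pell_odd w j))\<^sup>2 = 3 * w * (snd (pell_odd w j))\<^sup>2 + 1"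
proof (induction j)
  case (Suc j)
  obtain T U where TU: "pell_odd w j = (T, U)" by force
  have "(1 + 3 * w) * ((1 + 6 * w) * T + 6 * w * U)\<^sup>2
      - 3 * w * ((1 + 6 * w) * U + 2 * (1 + 3 * w) * T)\<^sup>2 = (1 + 3 * w) * T\<^sup>2 - 3 * w * U\<^sup>2"
    by Groebner_Basis.algebra
  also have "\<dots> = 1" using Suc TU by simp
  finally show ?case by (simp add: TU)
qed simp

text \<open>First-order expansion in \<open>w\<close>. That of \<open>T\<close> is carried along
  because the recursion for \<open>U\<close> involves \<open>T\<close>.\<close>

lemma pell_odd_expansion:
  "\<exists>p r. fst (pell_odd w j) = 1 + 6 * int j * (int j + 1) * w + w\<^sup>2 * p \<and>
     snd (pell_odd w j) = 2 * int j + 1 + 2 * int j * (int j + 1) * (2 * int j + 1) * w + w\<^sup>2 * r"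
proof (induction j)
  case (Suc j)
  define J where "J = int j"
  obtain T U where TU: "pell_odd w j = (T, U)" by force
  with Suc obtain p r where T: "T = 1 + 6 * J * (J + 1) * w + w\<^sup>2 * p"
    and U: "U = 2 * J + 1 + 2 * J * (J + 1) * (2 * J + 1) * w + w\<^sup>2 * r"
    by (auto simp: J_def)
  have iJ: "int (Suc j) = J + 1" by (simp add: J_def)
  have "(1 + 6 * w) * T + 6 * w * U = 1 + 6 * (J + 1) * (J + 1 + 1) * w + w\<^sup>2 *
      (p + 36 * J * (J + 1) + 6 * w * p + 12 * J * (J + 1) * (2 * J + 1) + 6 * w * r)"
    unfolding T U by Groebner_Basis.algebra
  moreover have "(1 + 6 * w) * U + 2 * (1 + 3 * w) * T =
      2 * (J + 1) + 1 + 2 * (J + 1) * (J + 1 + 1) * (2 * (J + 1) + 1) * w + w\<^sup>2 *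
      (r + 12 * J * (J + 1) * (2 * J + 1) + 6 * w * r + 2 * p + 36 * J * (J + 1) + 6 * w * p)"
    unfolding T U by Groebner_Basis.algebra
  ultimately show ?case unfolding iJ by (auto simp: TU)
qed (auto intro: exI[of _ 0])

text \<open>The two linear factors share the work: the odd part of \<open>s\<close> divides
  \<open>2 * x + 1\<close> and the power of 2 divides \<open>3 * x + 1\<close>.\<close>

lemma D_poly_root_mod:
  fixes s :: int
  assumes "s \<noteq> 0"
  obtains x where "s dvd poly D_poly x"
proof -
  obtain m where m: "s = 2 ^ multiplicity 2 s * m" "\<not> 2 dvd m"
    using multiplicity_decompose'[of s 2] assms by auto
  define a where "a = multiplicity 2 s"
  \<comment> \<open>The extra factor 2 is lost when
    \<open>3 * (2 * x + 1) - 1 = 2 * (3 * x + 1)\<close> is halved.\<close>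
  have "coprime (3 * m) (2 ^ Suc a)"
    using m(2) by (auto simp: coprime_power_right_iff coprime_mult_left_iff)
  then obtain v u where "3 * m * v + 2 ^ Suc a * u = 1"
    by (metis bezout_int coprime_imp_gcd_eq_1 mult.commute)
  then have vu: "3 * (m * v) = 1 - 2 * (2 ^ a * u)" by simp
  have "odd (3 * (m * v))" unfolding vu by simp
  then have "odd (m * v)" by simp
  then obtain x where x: "m * v = 2 * x + 1" by (rule oddE)
  have "3 * x + 1 = 2 ^ a * (- u)" using vu x by simp
  then have "poly D_poly x = 2 ^ a * m * (v * - u)"
    unfolding poly_D_poly x[symmetric] by simp
  then have "s dvd poly D_poly x" using m(1) by (simp add: a_def flip: m(1))
  then show ?thesis using that by blast
qed

lemma poly_D_poly_cong:
  assumes "s dvd x - x0" "s dvd poly D_poly x0"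
  shows "s dvd poly D_poly x"
proof -
  have "poly D_poly x = poly D_poly x0 + (x - x0) * (6 * (x + x0) + 5)"
    by (simp add: poly_D_poly algebra_simps)
  then show ?thesis using assms by simp
qed

text \<open>The factor \<open>U\<close> of the solution \<open>a T + y U \<surd>3\<close> above should be
  \<open>2 m + 1 - x y\<^sup>2\<close>. With \<open>j = m - e y\<^sup>2 / 2\<close> the expansion of \<open>U\<close> modulo \<open>y\<^sup>4\<close> provides such
  an \<open>x\<close>, congruent to \<open>e - 2 m (m + 1) (2 m + 1)\<close> modulo \<open>y\<close>; hence the choice of \<open>e\<close>,
  made so negative that \<open>j \<ge> 0\<close>.\<close>

lemma pell_odd_representation:
  fixes y m x0 :: int
  assumes "even y" "y \<noteq> 0"
  obtains j x where "snd (pell_odd (y\<^sup>2) j) = 2 * m + 1 - x * y\<^sup>2" "y dvd x - x0"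
proof -
  obtain k where k: "y = 2 * k" using assms(1) by (rule evenE)
  define e0 where "e0 = x0 + 2 * m * (m + 1) * (2 * m + 1)"
  define e where "e = e0 - y\<^sup>2 * (\<bar>e0\<bar> + \<bar>m\<bar>)"
  have "y\<^sup>2 \<ge> 1" using assms(2) by (simp add: int_one_le_iff_zero_less)
  then have "1 * (\<bar>e0\<bar> + \<bar>m\<bar>) \<le> y\<^sup>2 * (\<bar>e0\<bar> + \<bar>m\<bar>)" by (intro mult_right_mono) auto
  then have e: "e \<le> - \<bar>m\<bar>" unfolding e_def mult_1 by linarith
  have "y * k = 2 * k\<^sup>2" by (simp add: k power2_eq_square)
  moreover have "k\<^sup>2 \<ge> 1" using assms(2) k by (simp add: int_one_le_iff_zero_less)
  ultimately have yk: "y * k \<ge> 1" by simp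
  have "e * (y * k) \<le> e * 1" using e yk by (intro mult_left_mono_neg) auto
  then have "m - e * (y * k) \<ge> 0" using e by linarith
  then obtain j where j: "int j = m - e * (y * k)" by (metis nonneg_int_cases)
  define J where "J = int j"
  define x where "x = e - 2 * J * (J + 1) * (2 * J + 1)"
  obtain r where r: "snd (pell_odd (y\<^sup>2) j) =
      2 * J + 1 + 2 * J * (J + 1) * (2 * J + 1) * y\<^sup>2 + (y\<^sup>2)\<^sup>2 * r"
    using pell_odd_expansion[of "y\<^sup>2" j] unfolding J_def by blast
  have JM: "J = m - e * (y * k)" by (simp add: J_def j)
  have "2 * J = 2 * m - e * y\<^sup>2" by (simp add: JM k power2_eq_square)
  then have "snd (pell_odd (y\<^sup>2) j) = 2 * m + 1 - (x - y\<^sup>2 * r) * y\<^sup>2"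
    unfolding r x_def by Groebner_Basis.algebra
  moreover have "y dvd x - y\<^sup>2 * r - x0"
  proof -
    have "x - y\<^sup>2 * r - x0 = - y * (y * (\<bar>e0\<bar> + \<bar>m\<bar>) + y * r)
        + (2 * m * (m + 1) * (2 * m + 1) - 2 * J * (J + 1) * (2 * J + 1))"
      by (simp add: x_def e_def e0_def power2_eq_square algebra_simps)
    \<comment> \<open>Since \<open>J\<close> is congruent to \<open>m\<close> modulo
      \<open>y\<close>, the two cubic terms agree modulo \<open>y\<close>.\<close>
    moreover have "2 * m * (m + 1) * (2 * m + 1) - 2 * J * (J + 1) * (2 * J + 1)
        = (m - J) * (4 * (m\<^sup>2 + m * J + J\<^sup>2) + 6 * (m + J) + 2)"
      by Groebner_Basis.algebra
    moreover have "y dvd m - J" by (simp add: JM)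
    ultimately show ?thesis by simp
  qed
  ultimately show ?thesis using that by blast
qed

text \<open>The choices are made in order: first \<open>y\<close>, which fixes \<open>v\<close>,
  then a root \<open>x0\<close> of D modulo \<open>v * t\<close>, and last \<open>x\<close>
  congruent to \<open>x0\<close> modulo \<open>y\<close>, hence modulo its divisor
  \<open>v * t\<close>.\<close>

lemma exists_int_solution:
  fixes m1 m2 h t :: int
  assumes "t \<noteq> 0" "h \<noteq> 0"
  obtains v x b c where
    "b\<^sup>2 = 3 * (v * t * h)\<^sup>2 + 1"
    "c\<^sup>2 = 3 * (v * t * h)\<^sup>2 * (2 * (m1 + (v * t * h) * m2) + 1 - x * (v * t * h)\<^sup>2)\<^sup>2 + 1"
    "v * t dvd poly D_poly x"
proof -
  \<comment> \<open>The factor 2 makes \<open>y\<close> even, as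
    \<open>pell_odd_representation\<close> requires.\<close>
  have "2 * t * h \<noteq> 0" using assms by simp
  then obtain a y where y: "a\<^sup>2 = 3 * y\<^sup>2 + 1" "2 * t * h dvd y" "y \<noteq> 0"
    using pell_multiple by blast
  from y(2) obtain u where u: "y = 2 * t * h * u" ..
  define v where "v = 2 * u"
  have yv: "v * t * h = y" by (simp add: u v_def)
  have "v * t \<noteq> 0" using y(3) yv by auto
  then obtain x0 where x0: "v * t dvd poly D_poly x0" using D_poly_root_mod by blast
  have "even y" by (simp add: u)
  then obtain j x where U: "snd (pell_odd (y\<^sup>2) j) = 2 * (m1 + y * m2) + 1 - x * y\<^sup>2"
    and x: "y dvd x - x0"
    using pell_odd_representation[OF _ y(3)] by blast
  have "(a * fst (pell_odd (y\<^sup>2) j))\<^sup>2 = (1 + 3 * y\<^sup>2) * (fst (pell_odd (y\<^sup>2) j))\<^sup>2"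
    by (simp add: power_mult_distrib y(1) add.commute)
  then have "(a * fst (pell_odd (y\<^sup>2) j))\<^sup>2 =
      3 * y\<^sup>2 * (2 * (m1 + y * m2) + 1 - x * y\<^sup>2)\<^sup>2 + 1"
    by (simp only: pell_odd_eq U)
  moreover have "v * t dvd y" using yv by (metis dvd_triv_left)
  then have "v * t dvd poly D_poly x"
    using poly_D_poly_cong x x0 dvd_trans by blast
  ultimately show ?thesis using that[where v = v and x = x] y(1) unfolding yv by blast
qed

section \<open>The cycle of implications (1) to (2) to (3) to (1)\<close>

theorem proposition3p3:
  fixes d :: nat and K OK :: "complex set" and z1 z2 h :: complex
  assumes "d > 0" and "squarefree d"
    and K_def: "K = imag_quadratic_field d"
    and OK_def: "OK = ring_of_integers K"
    and "z1 \<in> OK" and "z2 \<in> OK"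
    and h_def: "h = H0 z1 * H0 z2"
  defines "P1 \<equiv> z1 \<in> \<int> \<and> z2 \<in> \<int>"
    and "P2 \<equiv> \<forall>t::int. t \<noteq> 0 \<longrightarrow> (\<exists>v x :: int.
           let s = v * t;
               y = of_int s * h;
               b = 3 * y\<^sup>2 + 1;
               c = 3 * y\<^sup>2 * (2 * (z1 + y * z2) + 1 - of_int x * y\<^sup>2)\<^sup>2 + 1
           in b \<in> Sq \<int> \<and> c \<in> Sq \<int> \<and> s dvd poly D_poly x)"
    and "P3 \<equiv> \<exists>s \<in> OK - {0}. \<exists>x \<in> OK.
           let y = s * h;
               b = 3 * y\<^sup>2 + 1;
               c = 3 * y\<^sup>2 * (2 * (z1 + y * z2) + 1 - x * y\<^sup>2)\<^sup>2 + 1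
           in b \<in> Sq OK \<and> c \<in> Sq OK"
  shows "h \<in> OK - {0} \<and> (P1 \<longleftrightarrow> P2) \<and> (P2 \<longleftrightarrow> P3)"
proof -
  interpret cnj_closed_subring OK
    unfolding OK_def K_def by (rule cnj_closed_subring_imag_quadratic) fact
  have z: "z1 \<in> OK" "z2 \<in> OK" by fact+
  have h: "h \<in> OK" "h \<noteq> 0" using z by (auto simp: h_def mult_mem H0_mem H0_nonzero)
  have of_int_mem: "of_int k \<in> OK" for k
    by (cases k rule: int_cases2) (auto simp: of_nat_mem minus_mem)
  have Sq_mono: "Sq \<int> \<subseteq> Sq OK" by (auto simp: Sq_def Ints_def of_int_mem)
  have "P2" if "P1"
  proof -
    obtain m1 m2 where m: "z1 = of_int m1" "z2 = of_int m2"
      using \<open>P1\<close> unfolding P1_def by (auto elim!: Ints_cases)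
    define k where "k = (2 * (2 * m1 + 1)\<^sup>2 + 1) * (2 * (2 * m2 + 1)\<^sup>2 + 1)"
    have hk: "h = of_int k" by (simp add: h_def H0_eq m k_def)
    with h have "k \<noteq> 0" by auto
    show "P2"
      unfolding P2_def Let_def
    proof (intro allI impI)
      fix t :: int assume "t \<noteq> 0"
      obtain v x b c where
        b: "b\<^sup>2 = 3 * (v * t * k)\<^sup>2 + 1" and
        c: "c\<^sup>2 = 3 * (v * t * k)\<^sup>2 * (2 * (m1 + (v * t * k) * m2) + 1 - x * (v * t * k)\<^sup>2)\<^sup>2 + 1"
        and dvd: "v * t dvd poly D_poly x"
        using exists_int_solution[OF \<open>t \<noteq> 0\<close> \<open>k \<noteq> 0\<close>, of m1 m2] .
      let ?y = "of_int (v * t) * h"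
      have "3 * ?y\<^sup>2 + 1 = (of_int b)\<^sup>2"
        unfolding of_int_power[symmetric] b by (simp add: hk)
      moreover have "3 * ?y\<^sup>2 * (2 * (z1 + ?y * z2) + 1 - of_int x * ?y\<^sup>2)\<^sup>2 + 1 = (of_int c)\<^sup>2"
        unfolding of_int_power[symmetric] c by (simp add: hk m)
      ultimately show "\<exists>v x. 3 * (of_int (v * t) * h)\<^sup>2 + 1 \<in> Sq \<int> \<and>
          3 * (of_int (v * t) * h)\<^sup>2 * (2 * (z1 + of_int (v * t) * h * z2) + 1 -
            of_int x * (of_int (v * t) * h)\<^sup>2)\<^sup>2 + 1 \<in> Sq \<int> \<and> v * t dvd poly D_poly x"
        using dvd unfolding Sq_def by (intro exI[of _ v] exI[of _ x]) auto
    qed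
  qed
  moreover have "P3" if "P2"
  proof -
    obtain v x :: int where vx: "3 * (of_int v * h)\<^sup>2 + 1 \<in> Sq \<int>"
      "3 * (of_int v * h)\<^sup>2 * (2 * (z1 + of_int v * h * z2) + 1 -
        of_int x * (of_int v * h)\<^sup>2)\<^sup>2 + 1 \<in> Sq \<int>" "v dvd poly D_poly x"
      using \<open>P2\<close>[unfolded P2_def Let_def, rule_format, of 1] by auto
    \<comment> \<open>Zero divides only zero and D has no integral root, so the divisibility in (2)
      keeps \<open>s\<close> nonzero.\<close>
    have "2 * x + 1 \<noteq> 0" "3 * x + 1 \<noteq> 0" by presburger+
    then have "v \<noteq> 0" using vx(3) by (auto simp: poly_D_poly)
    then have "of_int v \<in> OK - {0}" by (simp add: of_int_mem)
    then show "P3"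
      unfolding P3_def Let_def using vx(1,2) Sq_mono of_int_mem by blast
  qed
  moreover have "P1" if "P3"
    using \<open>P3\<close> Ints_if_squares[OF z] unfolding P3_def P1_def Let_def h_def by blast
  ultimately show ?thesis using h by blast
qed

end
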